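(* Let $X$ be a Banach space of holomorphic functions on $\mathbb{D}$ containing the constant function $\mathbf{1}$ and such that there is a continuous injection $X \to \mathrm{Hol}(\mathbb{D})$. Let $w:\mathbb{D}\to\mathbb{C}$ and $\varphi:\mathbb{D}\to\mathbb{D}$ be holomorphic, where $\varphi$ is not an elliptic automorphism, and suppose that the weighted composition operator $T_{w,\varphi}$ is a bounded operator on $X$ with $\sup_n\|T_{w,\varphi}^n\|<\infty$. Suppose that $\alpha := \mathrm{DW}(\varphi)\in\mathbb{D}$ and that either $|w(\alpha)|<1$ or $w(\alpha)=1$. Then $(T_{w,\varphi}^n)$ converges uniformly (that is, in operator norm) if and only if $r_e(T_{w,\varphi})<1$.
   Context: $\mathbb{D}$ is the open unit disc and $\mathrm{Hol}(\mathbb{D})$ is the Fréchet space of holomorphic functions on $\mathbb{D}$ (topology of locally uniform convergence). The continuous injection $X\to\mathrm{Hol}(\mathbb{D})$ is the inclusion, so point evaluations at points of $\mathbb{D}$ are continuous functionals on $X$. The weighted composition operator is $(T_{w,\varphi}f)(z)=w(z)f(\varphi(z))$ for $f\in X$, $z\in\mathbb{D}$. An elliptic automorphism is an automorphism of $\mathbb{D}$ with a fixed point in $\mathbb{D}$. For holomorphic $\varphi:\mathbb{D}\to\mathbb{D}$ that is not an automorphism with a fixed point in $\mathbb{D}$, the Denjoy--Wolff point $\mathrm{DW}(\varphi)\in\overline{\mathbb{D}}$ is the point to which the iterates of $\varphi$ converge uniformly on compact subsets of $\mathbb{D}$. $r_e(T)$ denotes the essential spectral radius of a bounded operator $T$ on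 $X$. *)

theory Defs
  imports "HOL-Complex_Analysis.Complex_Analysis"
begin

class complex_vector = real_vector +
  fixes scaleC :: "complex \<Rightarrow> 'a \<Rightarrow> 'a"  (infixr "*\<^sub>C" 75)
  assumes scaleC_add_right: "a *\<^sub>C (x + y) = a *\<^sub>C x + a *\<^sub>C y"
    and scaleC_add_left: "(a + b) *\<^sub>C x = a *\<^sub>C x + b *\<^sub>C x"
    and scaleC_scaleC: "a *\<^sub>C (b *\<^sub>C x) = (a * b) *\<^sub>C x"
    and scaleC_one: "1 *\<^sub>C x = x"
    and scaleR_scaleC: "r *\<^sub>R x = complex_of_real r *\<^sub>C x"

class complex_normed_vector = complex_vector + real_normed_vector +
  assumes norm_scaleC: "norm (a *\<^sub>C x) = cmod a * norm x"

class complex_banach = complex_normed_vector + banach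

definition bounded_clinear :: "('a::complex_normed_vector \<Rightarrow> 'b::complex_normed_vector) \<Rightarrow> bool" where
  "bounded_clinear A \<longleftrightarrow> bounded_linear A \<and> (\<forall>c x. A (c *\<^sub>C x) = c *\<^sub>C A x)"

definition compact_operator :: "('a::complex_normed_vector \<Rightarrow> 'b::complex_normed_vector) \<Rightarrow> bool" where
  "compact_operator K \<longleftrightarrow> bounded_clinear K \<and> compact (closure (K ` cball 0 1))"

text \<open>The essential spectrum is the spectrum of the class of \<open>T\<close> in the Calkin algebra
  (bounded operators modulo compact operators): \<open>\<mu>\<close> lies outside it iff \<open>\<mu> - T\<close> has a
  two-sided bounded inverse \<open>S\<close> modulo compact operators.\<close>

definition ess_spectrum :: "('a::complex_normed_vector \<Rightarrow> 'a) \<Rightarrow> complex set" where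
  "ess_spectrum T = {\<mu>. \<not> (\<exists>S. bounded_clinear S \<and>
      compact_operator (\<lambda>x. (\<mu> *\<^sub>C S x - T (S x)) - x) \<and>
      compact_operator (\<lambda>x. S (\<mu> *\<^sub>C x - T x) - x))}"

text \<open>Inserting \<open>0\<close> matters only when the essential spectrum is empty, that is, in finite
  dimension, where the essential spectral radius is \<open>0\<close> by convention.\<close>

definition ess_spectral_radius :: "('a::complex_normed_vector \<Rightarrow> 'a) \<Rightarrow> real" where
  "ess_spectral_radius T = Sup (insert 0 (cmod ` ess_spectrum T))"

definition powers_converge_uniformly :: "('a::complex_normed_vector \<Rightarrow> 'a) \<Rightarrow> bool" where
  "powers_converge_uniformly T \<longleftrightarrow>
    (\<exists>P. bounded_clinear P \<and> (\<lambda>n. onorm (\<lambda>x. (T ^^ n) x - P x)) \<longlonglongrightarrow> 0)"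

abbreviation unit_disc :: "complex set" where
  "unit_disc \<equiv> ball 0 1"

text \<open>A Banach space of holomorphic functions on the disc is a complex Banach space \<open>'a\<close>
  together with the map \<open>J\<close> sending an element to the function it is; only the values of
  \<open>J f\<close> on the disc matter. The last condition is continuity of \<open>J\<close> at every \<open>f\<close>, for the
  topology of locally uniform convergence on the holomorphic functions.\<close>

definition holomorphic_function_space :: "('a::complex_banach \<Rightarrow> complex \<Rightarrow> complex) \<Rightarrow> bool" where
  "holomorphic_function_space J \<longleftrightarrow>
    (\<forall>f. J f holomorphic_on unit_disc) \<and>
    (\<forall>f g. \<forall>z\<in>unit_disc. J (f + g) z = J f z + J g z) \<and>
    (\<forall>c f. \<forall>z\<in>unit_disc. J (c *\<^sub>C f) z = c * J f z) \<and>
    (\<forall>f g. (\<forall>z\<in>unit_disc. J f z = J g z) \<longrightarrow> f = g) \<and>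
    (\<forall>f K. compact K \<and> K \<subseteq> unit_disc \<longrightarrow> uniform_limit K J (J f) (nhds f))"

definition weighted_composition_operator ::
  "('a::complex_banach \<Rightarrow> complex \<Rightarrow> complex) \<Rightarrow> (complex \<Rightarrow> complex) \<Rightarrow> (complex \<Rightarrow> complex) \<Rightarrow>
    ('a \<Rightarrow> 'a) \<Rightarrow> bool" where
  "weighted_composition_operator J w \<phi> T \<longleftrightarrow>
    (\<forall>f. \<forall>z\<in>unit_disc. J (T f) z = w z * J f (\<phi> z))"

definition disc_automorphism :: "(complex \<Rightarrow> complex) \<Rightarrow> bool" where
  "disc_automorphism \<phi> \<longleftrightarrow>
    \<phi> holomorphic_on unit_disc \<and> \<phi> ` unit_disc \<subseteq> unit_disc \<and>
    (\<exists>\<psi>. \<psi> holomorphic_on unit_disc \<and> \<psi> ` unit_disc \<subseteq> unit_disc \<and>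
      (\<forall>z\<in>unit_disc. \<psi> (\<phi> z) = z \<and> \<phi> (\<psi> z) = z))"

definition elliptic_automorphism :: "(complex \<Rightarrow> complex) \<Rightarrow> bool" where
  "elliptic_automorphism \<phi> \<longleftrightarrow> disc_automorphism \<phi> \<and> (\<exists>z\<in>unit_disc. \<phi> z = z)"

definition denjoy_wolff_point :: "(complex \<Rightarrow> complex) \<Rightarrow> complex \<Rightarrow> bool" where
  "denjoy_wolff_point \<phi> \<alpha> \<longleftrightarrow> \<alpha> \<in> cball 0 1 \<and>
    (\<forall>K. compact K \<and> K \<subseteq> unit_disc \<longrightarrow> uniform_limit K (\<lambda>n. \<phi> ^^ n) (\<lambda>_. \<alpha>) sequentially)"

end

theory Submission
  imports Defs
begin

text \<open>Comparing leading coefficients at \<open>\<alpha>\<close>, where \<open>\<bar>\<phi>'(\<alpha>)\<bar> < 1\<close>, shows that \<open>T\<close> has no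
  unimodular eigenvalue except possibly \<open>1\<close>, with eigenspace spanned by some \<open>u\<close>, where \<open>u(\<alpha>) = 1\<close>
  or \<open>u = 0\<close>. In either direction \<open>P f = f(\<alpha>) u\<close> is the only possible limit, and \<open>Q = T - P\<close>
  satisfies \<open>Q\<^sup>n = T\<^sup>n - P\<close>. If \<open>Q\<^sup>n \<rightarrow> 0\<close>, then \<open>\<mu> - Q\<close> is invertible for all \<open>\<bar>\<mu>\<bar> > r\<close> with some
  \<open>r < 1\<close>, so \<open>\<mu> - T\<close> is invertible modulo rank one. Conversely, if \<open>r\<^sub>e(T) < 1\<close>, then for
  \<open>\<bar>\<mu>\<bar> = 1\<close> the operator \<open>\<mu> - Q\<close> is injective with a left inverse modulo compact operators, hence
  bounded below, uniformly in \<open>\<mu>\<close> by compactness of the circle. An average over roots of unity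
  then yields \<open>\<parallel>Q\<^sup>n\<parallel> \<rightarrow> 0\<close> for the power-bounded \<open>Q\<close>.\<close>

section \<open>Complex-linear bounded operators\<close>

lemma bounded_linear_scaleC: "bounded_linear (\<lambda>x::'a::complex_normed_vector. c *\<^sub>C x)"
proof (rule bounded_linear_intro[where K = "cmod c"])
  show "c *\<^sub>C (r *\<^sub>R x) = r *\<^sub>R (c *\<^sub>C x)" for r and x :: 'a
    by (simp add: scaleR_scaleC scaleC_scaleC mult.commute)
qed (simp_all add: scaleC_add_right norm_scaleC mult.commute)

lemmas scaleC_zero_right [simp] = linear_0[OF bounded_linear.linear[OF bounded_linear_scaleC]]
lemmas scaleC_diff_right = linear_diff[OF bounded_linear.linear[OF bounded_linear_scaleC]]
lemmas scaleC_sum_right = linear_sum[OF bounded_linear.linear[OF bounded_linear_scaleC]]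

lemma bounded_linear_scaleC_left: "bounded_linear (\<lambda>c. c *\<^sub>C (x::'a::complex_normed_vector))"
proof (rule bounded_linear_intro[where K = "norm x"])
  show "(r *\<^sub>R c) *\<^sub>C x = r *\<^sub>R (c *\<^sub>C x)" for r c
    by (simp add: scaleR_scaleC scaleC_scaleC scaleR_conv_of_real)
qed (simp_all add: scaleC_add_left norm_scaleC)

lemmas scaleC_zero_left [simp] = linear_0[OF bounded_linear.linear[OF bounded_linear_scaleC_left]]
lemmas scaleC_diff_left = linear_diff[OF bounded_linear.linear[OF bounded_linear_scaleC_left]]
lemmas scaleC_sum_left = linear_sum[OF bounded_linear.linear[OF bounded_linear_scaleC_left]]

lemma bounded_clinear_bounded_linear: "bounded_clinear A \<Longrightarrow> bounded_linear A"
  and bounded_clinear_scaleC: "bounded_clinear A \<Longrightarrow> A (c *\<^sub>C x) = c *\<^sub>C A x"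
  by (auto simp: bounded_clinear_def)

lemma bounded_clinear_diff:
  "bounded_clinear A \<Longrightarrow> bounded_clinear B \<Longrightarrow> bounded_clinear (\<lambda>x. A x - B x)"
  by (simp add: bounded_clinear_def bounded_linear_sub scaleC_diff_right)

lemma bounded_clinear_add:
  "bounded_clinear A \<Longrightarrow> bounded_clinear B \<Longrightarrow> bounded_clinear (\<lambda>x. A x + B x)"
  by (simp add: bounded_clinear_def bounded_linear_add scaleC_add_right)

lemma bounded_clinear_compose:
  "bounded_clinear A \<Longrightarrow> bounded_clinear B \<Longrightarrow> bounded_clinear (\<lambda>x. A (B x))"
  by (simp add: bounded_clinear_def bounded_linear_compose)

lemma bounded_clinear_scaleC_const: "bounded_clinear (\<lambda>x. c *\<^sub>C x)"
  by (simp add: bounded_clinear_def bounded_linear_scaleC scaleC_scaleC mult.commute)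

lemma bounded_clinear_ident: "bounded_clinear (\<lambda>x. x)"
  by (simp add: bounded_clinear_def bounded_linear_ident)

lemma bounded_clinear_funpow:
  fixes A :: "'a::complex_normed_vector \<Rightarrow> 'a"
  shows "bounded_clinear A \<Longrightarrow> bounded_clinear (A ^^ n)"
proof (induction n)
  case 0
  then show ?case using bounded_clinear_ident by (simp add: id_def)
next
  case (Suc n)
  then show ?case using bounded_clinear_compose[of A "A ^^ n"] by (simp add: comp_def)
qed

text \<open>The bound from below, read at \<open>inv A y\<close>, becomes the norm bound
  \<open>1 / c\<close> for the inverse.\<close>

lemma bounded_clinear_inv:
  fixes A :: "'a::complex_normed_vector \<Rightarrow> 'b::complex_normed_vector"
  assumes "bounded_clinear A" "bij A" "0 < c" and below: "\<And>x. c * norm x \<le> norm (A x)"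
  shows "bounded_clinear (inv A)"
proof -
  interpret A: bounded_linear A
    using assms(1) by (rule bounded_clinear_bounded_linear)
  have AI: "A (inv A y) = y" for y
    using assms(2) by (simp add: bij_is_surj surj_f_inv_f)
  have IA: "inv A (A x) = x" for x
    using assms(2) by (simp add: bij_is_inj)
  have scale: "inv A (k *\<^sub>C y) = k *\<^sub>C inv A y" for k y
    using IA[of "k *\<^sub>C inv A y"] by (simp add: bounded_clinear_scaleC[OF assms(1)] AI)
  have "bounded_linear (inv A)"
  proof (rule bounded_linear_intro[where K = "1 / c"])
    show "inv A (x + y) = inv A x + inv A y" for x y
      using IA[of "inv A x + inv A y"] by (simp add: A.add AI)
    show "inv A (r *\<^sub>R x) = r *\<^sub>R inv A x" for r x
      by (simp add: scaleR_scaleC scale)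
    show "norm (inv A x) \<le> norm x * (1 / c)" for x
      using below[of "inv A x"] \<open>0 < c\<close> by (simp add: AI field_simps)
  qed
  then show ?thesis
    by (simp add: bounded_clinear_def scale)
qed

text \<open>Serves to make the point evaluation at \<alpha> bounded. Continuity at 0 bounds
  \<open>f\<close> on a small ball, and scaling spreads the bound to the whole space.\<close>

lemma bounded_linear_continuous_at_0:
  fixes f :: "'a::real_normed_vector \<Rightarrow> 'b::real_normed_vector"
  assumes "linear f" and "(f \<longlongrightarrow> 0) (nhds 0)"
  shows "bounded_linear f"
proof -
  interpret linear f by fact
  have "eventually (\<lambda>x. dist (f x) 0 < 1) (nhds 0)"
    using assms(2) by (rule tendstoD) simp
  then obtain d where d: "d > 0" "\<And>x. norm x < d \<Longrightarrow> norm (f x) < 1"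
    by (auto simp: eventually_nhds_metric)
  have "norm (f x) \<le> norm x * (2 / d)" for x
  proof (cases "x = 0")
    case False
    define r where "r = d / (2 * norm x)"
    have "r > 0" using False d(1) by (simp add: r_def)
    have "norm (f (r *\<^sub>R x)) < 1"
      by (rule d(2)) (use False d(1) in \<open>simp add: r_def\<close>)
    then have "r * norm (f x) < 1"
      using \<open>r > 0\<close> by (simp add: scale)
    then show ?thesis
      using False d(1) by (simp add: r_def field_simps)
  qed (simp add: zero)
  then show ?thesis
    by (intro bounded_linear_intro[where K = "2 / d"]) (auto simp: add scale)
qed

section \<open>Compact operators and the essential spectrum\<close>

lemma compact_closure_subset:
  fixes S :: "'a::t2_space set"
  assumes "compact C" "S \<subseteq> C"
  shows "compact (closure S)"
proof -
  have "closure S \<subseteq> C"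
    using assms by (intro closure_minimal compact_imp_closed)
  then show ?thesis
    using compact_Int_closed[OF assms(1) closed_closure, of S] by (simp add: inf.absorb2)
qed

lemma compact_operator_add:
  assumes "compact_operator K" "compact_operator L"
  shows "compact_operator (\<lambda>x. K x + L x)"
proof -
  have "compact {x + y | x y. x \<in> closure (K ` cball 0 1) \<and> y \<in> closure (L ` cball 0 1)}"
    using assms by (intro compact_sums) (auto simp: compact_operator_def)
  moreover have "(\<lambda>x. K x + L x) ` cball 0 1 \<subseteq>
      {x + y | x y. x \<in> closure (K ` cball 0 1) \<and> y \<in> closure (L ` cball 0 1)}"
    using closure_subset[of "K ` cball 0 1"] closure_subset[of "L ` cball 0 1"] by blast
  ultimately have "compact (closure ((\<lambda>x. K x + L x) ` cball 0 1))"
    by (rule compact_closure_subset)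
  then show ?thesis
    using assms by (simp add: compact_operator_def bounded_clinear_add)
qed

text \<open>The image of the unit ball lies in the set of multiples of \<open>u\<close> by scalars
  from a closed disc, which is compact.\<close>

lemma compact_operator_rank_one:
  assumes "bounded_clinear P" and range: "\<And>x. \<exists>c. P x = c *\<^sub>C u"
  shows "compact_operator P"
proof -
  interpret P: bounded_linear P
    using assms(1) by (rule bounded_clinear_bounded_linear)
  \<comment> \<open>For \<open>u = 0\<close> the radius is 0 by the convention for division by zero,
    and \<open>C\<close> is \<open>{0}\<close>.\<close>
  define C where "C = (\<lambda>c. c *\<^sub>C u) ` cball 0 (onorm P / norm u)"
  have "compact C"
    unfolding C_def
    by (intro compact_continuous_image linear_continuous_on bounded_linear_scaleC_left) simp
  have "P ` cball 0 1 \<subseteq> C"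
  proof safe
    fix x :: 'a
    assume "x \<in> cball 0 1"
    then have x: "norm x \<le> 1" by simp
    obtain c where c: "P x = c *\<^sub>C u" using range by blast
    have "norm (P x) \<le> onorm P * norm x"
      by (rule onorm) (rule P.bounded_linear_axioms)
    also have "\<dots> \<le> onorm P"
      using x by (simp add: mult_left_le onorm_pos_le P.bounded_linear_axioms)
    finally have *: "cmod c * norm u \<le> onorm P"
      by (simp add: c norm_scaleC)
    show "P x \<in> C"
    proof (cases "u = 0")
      case True
      then show ?thesis using c by (auto simp: C_def)
    next
      case False
      then have "c \<in> cball 0 (onorm P / norm u)"
        using * by (simp add: field_simps)
      then show ?thesis using c by (auto simp: C_def)
    qed
  qed
  then show ?thesis
    using assms(1) compact_closure_subset[OF \<open>compact C\<close>] by (simp add: compact_operator_def)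
qed

text \<open>If no bound held, there would be unit vectors with \<open>A (x n)\<close> tending to 0.
  Since \<open>x = S (A x) - K x\<close> with \<open>K\<close> compact, a subsequence would converge
  to a unit vector in the kernel of \<open>A\<close>.\<close>

lemma bounded_below_if_left_inverse_mod_compact:
  assumes "bounded_clinear A" "bounded_clinear S"
    and compact: "compact_operator (\<lambda>x. S (A x) - x)"
    and inj: "\<And>x. A x = 0 \<Longrightarrow> x = 0"
  shows "\<exists>c>0. \<forall>x. c * norm x \<le> norm (A x)"
proof (rule ccontr)
  assume neg: "\<not> ?thesis"
  interpret A: bounded_linear A
    using assms(1) by (rule bounded_clinear_bounded_linear)
  interpret S: bounded_linear S
    using assms(2) by (rule bounded_clinear_bounded_linear)
  have "\<exists>x. norm x = 1 \<and> norm (A x) < inverse (real (Suc n))" for n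
  proof -
    obtain x where x: "norm (A x) < inverse (real (Suc n)) * norm x"
      using neg by (metis inverse_positive_iff_positive not_le of_nat_0_less_iff zero_less_Suc)
    then have "x \<noteq> 0" using A.zero by auto
    then show ?thesis
      using x by (intro exI[of _ "(1 / norm x) *\<^sub>R x"]) (simp add: A.scale field_simps)
  qed
  then obtain x where x: "\<And>n. norm (x n) = 1" "\<And>n. norm (A (x n)) < inverse (real (Suc n))"
    by metis
  have "(\<lambda>n. A (x n)) \<longlonglongrightarrow> 0"
    using x(2) by (intro Lim_null_comparison[OF _ LIMSEQ_inverse_real_of_nat] always_eventually)
      (auto simp only: less_imp_le)
  define K where "K x = S (A x) - x" for x
  have "seq_compact (closure (K ` cball 0 1))"
    using compact by (simp add: compact_operator_def K_def compact_eq_seq_compact_metric)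
  moreover have "\<forall>n. K (x n) \<in> closure (K ` cball 0 1)"
    using x(1) closure_subset[of "K ` cball 0 1"] by (auto simp: image_subset_iff)
  ultimately obtain l r where r: "strict_mono (r::nat\<Rightarrow>nat)" and l: "((\<lambda>n. K (x n)) \<circ> r) \<longlonglongrightarrow> l"
    unfolding seq_compact_def by (auto dest: spec[of _ "\<lambda>n. K (x n)"])
  have Ar: "(\<lambda>n. A (x (r n))) \<longlonglongrightarrow> 0"
    using LIMSEQ_subseq_LIMSEQ[OF \<open>(\<lambda>n. A (x n)) \<longlonglongrightarrow> 0\<close> r] by (simp add: comp_def)
  have "(\<lambda>n. S (A (x (r n))) - K (x (r n))) \<longlonglongrightarrow> S 0 - l"
    using S.tendsto[OF Ar] l by (intro tendsto_diff) (auto simp: comp_def)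
  then have lim: "(\<lambda>n. x (r n)) \<longlonglongrightarrow> - l"
    by (simp add: K_def S.zero)
  have "(\<lambda>n. A (x (r n))) \<longlonglongrightarrow> A (- l)"
    using lim by (rule A.tendsto)
  then have "A (- l) = 0"
    using Ar LIMSEQ_unique by blast
  then have "- l = 0" by (rule inj)
  moreover have "(\<lambda>n. norm (x (r n))) \<longlonglongrightarrow> norm (- l)"
    using lim by (rule tendsto_norm)
  ultimately show False
    by (simp add: x(1) LIMSEQ_const_iff)
qed

section \<open>Inverting \<open>1 - B\<close> when a power of \<open>B\<close> is a
  contraction\<close>

lemma surj_diff_contraction:
  fixes B :: "'a::banach \<Rightarrow> 'a"
  assumes "bounded_linear B" "q < 1" "0 \<le> q" "\<And>x. norm (B x) \<le> q * norm x"
  shows "surj (\<lambda>x. x - B x)"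
proof (rule surjI)
  interpret bounded_linear B by fact
  fix y
  \<comment> \<open>The fixed point of this contraction is the preimage of \<open>y\<close>.\<close>
  have "\<exists>!x. y + B x = x"
    using assms by (intro banach_fix_type[of q]) (auto simp: dist_norm diff[symmetric])
  then have "\<exists>x. x - B x = y"
    by (metis add_diff_cancel_right')
  then show "(SOME x. x - B x = y) - B (SOME x. x - B x = y) = y"
    by (rule someI_ex)
qed

text \<open>The truncated Neumann series \<open>G\<close> satisfies
  \<open>(1 - B) G = G (1 - B) = 1 - B ^^ N\<close>. Surjectivity passes from
  \<open>1 - B ^^ N\<close> to \<open>1 - B\<close> through the first product, the bound from below
  through the second.\<close>

lemma bij_diff_power_contraction:
  fixes B :: "'a::banach \<Rightarrow> 'a"
  assumes "bounded_linear B" "\<And>n. bounded_linear (B ^^ n)"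
    and q: "q < 1" "0 \<le> q" "\<And>x. norm ((B ^^ N) x) \<le> q * norm x"
  shows "bij (\<lambda>x. x - B x)" and "\<exists>c>0. \<forall>x. c * norm x \<le> norm (x - B x)"
proof -
  interpret B: bounded_linear B by fact
  define G where "G x = (\<Sum>j<N. (B ^^ j) x)" for x
  have G: "bounded_linear G"
    unfolding G_def by (intro bounded_linear_sum assms)
  interpret G: bounded_linear G by fact
  have BG: "G x - B (G x) = x - (B ^^ N) x" for x
    using sum_lessThan_telescope'[of "\<lambda>j. (B ^^ j) x" N] by (simp add: G_def B.sum sum_subtractf)
  have GB: "G (x - B x) = x - (B ^^ N) x" for x
  proof -
    have "G (B x) = B (G x)"
      by (simp add: G_def B.sum funpow_swap1)
    then show ?thesis using BG by (simp add: G.diff)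
  qed
  have "y \<in> range (\<lambda>x. x - B x)" for y
  proof -
    have "surj (\<lambda>x. x - (B ^^ N) x)"
      using assms by (intro surj_diff_contraction[of _ q]) auto
    then obtain x where "x - (B ^^ N) x = y" by (metis surjD)
    then have "y = G x - B (G x)" using BG by simp
    then show ?thesis by blast
  qed
  then have surj: "surj (\<lambda>x. x - B x)" by blast
  obtain D where D: "D > 0" "\<And>x. norm (G x) \<le> norm x * D"
    using G.pos_bounded by blast
  define c where "c = (1 - q) / D"
  have c: "c > 0" using D q by (simp add: c_def)
  have below: "c * norm x \<le> norm (x - B x)" for x
  proof -
    have "(1 - q) * norm x \<le> norm x - norm ((B ^^ N) x)"
      using q(3)[of x] by (simp add: algebra_simps)
    also have "\<dots> \<le> norm (G (x - B x))"
      unfolding GB by (rule norm_triangle_ineq2)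
    also have "\<dots> \<le> norm (x - B x) * D" by (rule D)
    finally show ?thesis using D(1) by (simp add: c_def field_simps)
  qed
  then show "\<exists>c>0. \<forall>x. c * norm x \<le> norm (x - B x)" using c by blast
  have "inj (\<lambda>x. x - B x)"
  proof (rule injI)
    fix x y
    assume "x - B x = y - B y"
    then have "(x - y) - B (x - y) = 0" by (simp add: B.diff algebra_simps)
    then show "x = y" using below[of "x - y"] c by (simp add: mult_le_0_iff)
  qed
  then show "bij (\<lambda>x. x - B x)" using surj by (simp add: bij_def)
qed

section \<open>Scalars outside the essential spectrum\<close>

lemma funpow_scaleC:
  fixes Q :: "'a::complex_normed_vector \<Rightarrow> 'a"
  assumes "bounded_clinear Q"
  shows "((\<lambda>x. c *\<^sub>C Q x) ^^ n) x = c ^ n *\<^sub>C (Q ^^ n) x"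
  by (induction n) (auto simp: scaleC_one bounded_clinear_scaleC[OF assms] scaleC_scaleC)

text \<open>For \<open>S = (\<mu> - Q)\<^sup>-\<^sup>1\<close>, both \<open>(\<mu> - T)S - 1\<close> and \<open>S(\<mu> - T) - 1\<close> have rank at most one.\<close>

lemma not_in_ess_spectrum:
  fixes T Q :: "'a::complex_banach \<Rightarrow> 'a"
  assumes "bounded_clinear T" and Q: "bounded_clinear Q"
    and q: "0 \<le> q" "\<And>x. norm ((Q ^^ N) x) \<le> q * norm x" "q < cmod \<mu> ^ N" "\<mu> \<noteq> 0"
    and range: "\<And>x. \<exists>c. T x - Q x = c *\<^sub>C u"
  shows "\<mu> \<notin> ess_spectrum T"
proof -
  \<comment> \<open>\<open>B ^^ N\<close> contracts by the factor \<open>q / cmod \<mu> ^ N\<close>,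
    which is below 1, so \<open>1 - B\<close> is invertible, and with it
    \<open>A = \<mu> (1 - B) = \<mu> - Q\<close>.\<close>
  define B where "B x = (1 / \<mu>) *\<^sub>C Q x" for x
  have B: "bounded_clinear B"
    unfolding B_def by (intro bounded_clinear_compose[OF bounded_clinear_scaleC_const] Q)
  have small: "norm ((B ^^ N) x) \<le> q / cmod \<mu> ^ N * norm x" for x
    using q(2)[of x] q(4) unfolding B_def
    by (simp add: funpow_scaleC[OF Q] norm_scaleC norm_divide norm_power power_divide divide_right_mono)
  have less: "q / cmod \<mu> ^ N < 1" "0 \<le> q / cmod \<mu> ^ N"
    using q by auto
  note bij = bij_diff_power_contraction[OF bounded_clinear_bounded_linear[OF B]
      bounded_clinear_bounded_linear[OF bounded_clinear_funpow[OF B]] less small]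
  define A where "A x = \<mu> *\<^sub>C x - Q x" for x
  have A_eq: "A = (\<lambda>x. \<mu> *\<^sub>C x) \<circ> (\<lambda>x. x - B x)"
    using q(4) by (auto simp: A_def B_def scaleC_diff_right scaleC_scaleC scaleC_one)
  have "bij (\<lambda>x::'a. \<mu> *\<^sub>C x)"
    using q(4) by (intro o_bij[of "\<lambda>x. (1 / \<mu>) *\<^sub>C x"]) (auto simp: scaleC_scaleC scaleC_one)
  then have bijA: "bij A"
    unfolding A_eq using bij(1) by (rule bij_comp[rotated])
  obtain c where c: "c > 0" "\<And>x. c * norm x \<le> norm (x - B x)"
    using bij(2) by blast
  have "cmod \<mu> * c * norm x \<le> norm (A x)" for x
    using c(2)[of x] by (simp add: A_eq norm_scaleC mult_left_mono mult.assoc)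
  moreover have A: "bounded_clinear A"
    unfolding A_def by (intro bounded_clinear_diff bounded_clinear_scaleC_const Q)
  ultimately have S: "bounded_clinear (inv A)"
    using bijA c(1) q(4) by (intro bounded_clinear_inv[of A "cmod \<mu> * c"]) auto
  interpret S: bounded_linear "inv A"
    using S by (rule bounded_clinear_bounded_linear)
  have AS: "A (inv A y) = y" and SA: "inv A (A y) = y" for y
    using bijA by (simp_all add: bij_is_surj surj_f_inv_f bij_is_inj)
  have id: "bounded_clinear (\<lambda>x::'a. x)" by (rule bounded_clinear_ident)
  have muT: "bounded_clinear (\<lambda>x. \<mu> *\<^sub>C x - T x)"
    by (intro bounded_clinear_diff bounded_clinear_scaleC_const assms)
  have eq: "\<mu> *\<^sub>C x - T x = A x - (T x - Q x)" for x
    by (simp add: A_def)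
  have "compact_operator (\<lambda>x. (\<mu> *\<^sub>C inv A x - T (inv A x)) - x)"
  proof (rule compact_operator_rank_one)
    show "bounded_clinear (\<lambda>x. (\<mu> *\<^sub>C inv A x - T (inv A x)) - x)"
      using bounded_clinear_diff[OF bounded_clinear_compose[OF muT S] id] by simp
    show "\<exists>c. (\<mu> *\<^sub>C inv A x - T (inv A x)) - x = c *\<^sub>C u" for x
    proof -
      obtain c where "T (inv A x) - Q (inv A x) = c *\<^sub>C u" using range by blast
      then have "(\<mu> *\<^sub>C inv A x - T (inv A x)) - x = (0 - c) *\<^sub>C u"
        unfolding eq scaleC_diff_left by (simp add: AS)
      then show ?thesis by blast
    qed
  qed
  moreover have "compact_operator (\<lambda>x. inv A (\<mu> *\<^sub>C x - T x) - x)"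
  proof (rule compact_operator_rank_one)
    show "bounded_clinear (\<lambda>x. inv A (\<mu> *\<^sub>C x - T x) - x)"
      using bounded_clinear_diff[OF bounded_clinear_compose[OF S muT] id] by simp
    show "\<exists>c. inv A (\<mu> *\<^sub>C x - T x) - x = c *\<^sub>C inv A u" for x
    proof -
      obtain c where "T x - Q x = c *\<^sub>C u" using range by blast
      then have "inv A (\<mu> *\<^sub>C x - T x) - x = (0 - c) *\<^sub>C inv A u"
        unfolding eq scaleC_diff_left by (simp add: S.diff SA bounded_clinear_scaleC[OF S])
      then show ?thesis by blast
    qed
  qed
  ultimately show ?thesis
    using S by (auto simp: ess_spectrum_def)
qed

section \<open>Powers of operators bounded below on the unit circle\<close>

text \<open>Replacing \<nu> by \<mu> changes the norm by at most
  \<open>dist \<nu> \<mu> * norm x\<close>, so half the constant at \<nu> still works on the ball of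
  radius \<open>C \<nu> / 2\<close>. Finitely many such balls cover the circle.\<close>

lemma uniformly_bounded_below_on_circle:
  assumes "\<And>\<mu>. cmod \<mu> = 1 \<Longrightarrow> \<exists>c>0. \<forall>x::'a::complex_normed_vector. c * norm x \<le> norm (\<mu> *\<^sub>C x - Q x)"
  shows "\<exists>c>0. \<forall>\<mu>. cmod \<mu> = 1 \<longrightarrow> (\<forall>x. c * norm x \<le> norm (\<mu> *\<^sub>C x - Q x))"
proof -
  obtain C where C: "\<And>\<mu>. cmod \<mu> = 1 \<Longrightarrow> C \<mu> > 0"
    "\<And>\<mu> x. cmod \<mu> = 1 \<Longrightarrow> C \<mu> * norm x \<le> norm (\<mu> *\<^sub>C x - Q x)"
    using assms by metis
  have cover: "sphere 0 1 \<subseteq> (\<Union>\<mu>\<in>sphere 0 1. ball \<mu> (C \<mu> / 2))"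
    using C(1) by (force simp: dist_norm)
  then obtain F where F: "F \<subseteq> sphere 0 1" "finite F" "sphere 0 1 \<subseteq> (\<Union>\<mu>\<in>F. ball \<mu> (C \<mu> / 2))"
    using compactE_image[OF compact_sphere open_ball cover] by blast
  have "1 \<in> sphere (0::complex) 1" by simp
  then have "F \<noteq> {}" using F(3) by blast
  define c where "c = Min ((\<lambda>\<mu>. C \<mu> / 2) ` F)"
  have "c > 0"
    using F C(1) \<open>F \<noteq> {}\<close> unfolding c_def by (subst Min_gr_iff) (auto simp: subset_eq)
  moreover have "c * norm x \<le> norm (\<mu> *\<^sub>C x - Q x)" if \<mu>: "cmod \<mu> = 1" for \<mu> x
  proof -
    obtain \<nu> where \<nu>: "\<nu> \<in> F" "dist \<nu> \<mu> < C \<nu> / 2"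
      using F(3) \<mu> by fastforce
    then have "cmod \<nu> = 1" using F(1) by auto
    have "norm (\<nu> *\<^sub>C x - \<mu> *\<^sub>C x) \<le> C \<nu> / 2 * norm x"
      using \<nu>(2) unfolding scaleC_diff_left[symmetric] norm_scaleC dist_norm
      by (intro mult_right_mono) auto
    moreover have "C \<nu> * norm x \<le> norm (\<nu> *\<^sub>C x - Q x)"
      using C(2) \<open>cmod \<nu> = 1\<close> by blast
    moreover have "norm (\<nu> *\<^sub>C x - Q x) \<le> norm (\<mu> *\<^sub>C x - Q x) + norm (\<nu> *\<^sub>C x - \<mu> *\<^sub>C x)"
      using norm_triangle_ineq[of "\<mu> *\<^sub>C x - Q x" "\<nu> *\<^sub>C x - \<mu> *\<^sub>C x"] by simp
    ultimately have "C \<nu> / 2 * norm x \<le> norm (\<mu> *\<^sub>C x - Q x)"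
      by simp
    moreover have "c \<le> C \<nu> / 2"
      unfolding c_def using \<nu>(1) F(2) by (intro Min_le) auto
    ultimately show ?thesis
      by (meson mult_right_mono norm_ge_zero order_trans)
  qed
  ultimately show ?thesis by blast
qed

section \<open>Alternating averages over roots of unity\<close>

lemma cis_pi_div_power:
  assumes "n > 0"
  shows "cis (pi / real n) ^ n = -1"
  unfolding Complex.DeMoivre using assms by simp

text \<open>The sum is geometric with ratio \<open>z = - (cis (pi / n) ^ j)\<close>, and
  \<open>z ^ (2 * n) = 1\<close>, so it vanishes unless \<open>z = 1\<close>. That requires
  \<open>j\<close> to be an odd multiple of \<open>n\<close>, which below \<open>2 * n\<close>
  leaves only \<open>j = n\<close>.\<close>

lemma sum_powers_root_of_unity:
  fixes n :: nat
  assumes "n > 0" "j < 2 * n"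
  shows "(\<Sum>k<2*n. (- 1) ^ k * (cis (pi / n) ^ k) ^ j) = (if j = n then 2 * of_nat n else 0)"
proof -
  define z where "z = - (cis (pi / n) ^ j)"
  have "(\<Sum>k<2*n. (- 1) ^ k * (cis (pi / n) ^ k) ^ j) = (\<Sum>k<2*n. z ^ k)"
    unfolding z_def by (intro sum.cong refl) (simp add: power_minus[of "_ ^ j"] mult.commute flip: power_mult)
  also have "\<dots> = (if j = n then 2 * of_nat n else 0)"
  proof (cases "j = n")
    case True
    then have "z = 1" using assms by (simp add: z_def cis_pi_div_power)
    then show ?thesis using True by simp
  next
    case False
    have "z \<noteq> 1"
    proof
      assume "z = 1"
      then have "cis (pi / n) ^ j = -1" unfolding z_def by (metis minus_minus)
      then have "cis (real j * (pi / n)) = -1" unfolding Complex.DeMoivre .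
      then have "cos (real j * (pi / n)) = -1" by (simp add: complex_eq_iff)
      then obtain m :: int where m: "real j * (pi / n) = (2 * m + 1) * pi"
        unfolding cos_eq_minus1 by auto
      then have "real j * pi = ((2 * m + 1) * real n) * pi"
        using assms(1) by (simp add: field_simps)
      then have "real j = (2 * m + 1) * real n"
        by (simp only: mult_right_cancel[OF pi_neq_zero])
      then have jm: "int j = (2 * m + 1) * int n"
        by (metis (no_types, lifting) of_int_1 of_int_add of_int_eq_iff of_int_mult of_int_numeral of_int_of_nat_eq)
      have "0 \<le> 2 * m + 1" using jm assms by (smt (verit) mult_neg_pos of_nat_0_less_iff of_nat_less_0_iff)
      moreover have "2 * m + 1 < 2"
      proof (rule ccontr)
        assume "\<not> ?thesis"
        then have "2 * int n \<le> (2 * m + 1) * int n" by (intro mult_right_mono) auto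
        then show False using jm assms(2) by linarith
      qed
      ultimately have "m = 0" by linarith
      then show False using jm False by simp
    qed
    moreover have "z ^ (2 * n) = 1"
    proof -
      have "z ^ (2 * n) = (cis (pi / n) ^ n) ^ (2 * j)"
        unfolding z_def by (simp add: power_mult[symmetric] mult_ac)
      also have "cis (pi / n) ^ n = -1" using assms by (simp add: cis_pi_div_power)
      finally show ?thesis by simp
    qed
    ultimately show ?thesis
      using False by (simp add: geometric_sum)
  qed
  finally show ?thesis .
qed

text \<open>With \<open>\<theta> = cis (\<pi> / n)\<close>, the solutions \<open>v k\<close> of \<open>(1 - \<theta>\<^sup>k Q) v = x - Q\<^sup>2\<^sup>n x\<close>
  vary slowly with \<open>k\<close>, while \<open>Q\<^sup>n x\<close> is their alternating average over \<open>k < 2n\<close>; so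
  \<open>Q\<^sup>n\<close> is small.\<close>

lemma funpow_norm_le:
  assumes Q: "bounded_clinear Q" and c: "c > 0"
    and below: "\<And>\<mu> x. cmod \<mu> = 1 \<Longrightarrow> c * norm x \<le> norm (\<mu> *\<^sub>C x - Q x)"
    and M: "\<And>n x. norm ((Q ^^ n) x) \<le> M * norm x" and n: "n > 0"
  shows "norm ((Q ^^ n) x) \<le> cmod (1 - cis (pi / n)) * (M * (1 + M) / (2 * c\<^sup>2)) * norm x"
proof -
  interpret Q: bounded_linear Q
    using Q by (rule bounded_clinear_bounded_linear)
  define \<theta> where "\<theta> = cis (pi / n)"
  define y where "y = x - (Q ^^ (2 * n)) x"
  define v where "v k = (\<Sum>j<2*n. (\<theta> ^ k) ^ j *\<^sub>C (Q ^^ j) x)" for k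
  have [simp]: "cmod \<theta> = 1" by (simp add: \<theta>_def)
  have root: "(\<theta> ^ k) ^ (2 * n) = 1" for k
  proof -
    have "(\<theta> ^ k) ^ (2 * n) = (\<theta> ^ n) ^ (2 * k)"
      by (simp add: power_mult[symmetric] mult_ac)
    also have "\<theta> ^ n = -1" using n by (simp add: \<theta>_def cis_pi_div_power)
    finally show ?thesis by simp
  qed
  \<comment> \<open>This is \<open>below\<close> at \<open>1 / \<omega>\<close>, multiplied by
    \<omega>.\<close>
  have below': "c * norm z \<le> norm (z - \<omega> *\<^sub>C Q z)" if "cmod \<omega> = 1" for \<omega> z
  proof -
    have "\<omega> \<noteq> 0" using that by auto
    then have "z - \<omega> *\<^sub>C Q z = \<omega> *\<^sub>C ((1 / \<omega>) *\<^sub>C z - Q z)"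
      by (simp add: scaleC_diff_right scaleC_scaleC scaleC_one)
    then have "norm (z - \<omega> *\<^sub>C Q z) = norm ((1 / \<omega>) *\<^sub>C z - Q z)"
      using that by (simp add: norm_scaleC)
    then show ?thesis using below[of "1 / \<omega>" z] that by (simp add: norm_divide)
  qed
  \<comment> \<open>The sum telescopes, and its last coefficient is
    \<open>(\<theta> ^ k) ^ (2 * n) = 1\<close>.\<close>
  have v: "v k - \<theta> ^ k *\<^sub>C Q (v k) = y" for k
  proof -
    have "v k - \<theta> ^ k *\<^sub>C Q (v k) =
        (\<Sum>j<2*n. (\<theta> ^ k) ^ j *\<^sub>C (Q ^^ j) x - (\<theta> ^ k) ^ Suc j *\<^sub>C (Q ^^ Suc j) x)"
      by (simp add: v_def Q.sum scaleC_sum_right sum_subtractf bounded_clinear_scaleC[OF Q] scaleC_scaleC)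
    also have "\<dots> = y"
      by (subst sum_lessThan_telescope') (simp add: root y_def scaleC_one)
    finally show ?thesis .
  qed
  have "norm y \<le> (1 + M) * norm x"
    using norm_triangle_ineq4[of x "(Q ^^ (2 * n)) x"] M[of "2 * n" x]
    by (simp add: y_def algebra_simps)
  have v_le: "c * norm (v k) \<le> (1 + M) * norm x" for k
    using below'[of "\<theta> ^ k" "v k"] \<open>norm y \<le> _\<close> by (simp add: v norm_power)
  \<comment> \<open>\<open>v k\<close> and \<open>v (Suc k)\<close> solve equations with the same
    right side \<open>y\<close>, so \<open>1 - \<theta> ^ k Q\<close> sends their difference to
    \<open>(\<theta> ^ k - \<theta> ^ Suc k) *\<^sub>C Q (v (Suc k))\<close>. The bound from below
    is used here and again for \<open>v (Suc k)\<close>, whence \<open>c\<^sup>2\<close>.\<close>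
  have diff: "norm (v k - v (Suc k)) \<le> cmod (1 - \<theta>) * M * (1 + M) / c\<^sup>2 * norm x" for k
  proof -
    have "(v k - v (Suc k)) - \<theta> ^ k *\<^sub>C Q (v k - v (Suc k)) =
      (v k - \<theta> ^ k *\<^sub>C Q (v k)) - (v (Suc k) - \<theta> ^ Suc k *\<^sub>C Q (v (Suc k))) +
      (\<theta> ^ k - \<theta> ^ Suc k) *\<^sub>C Q (v (Suc k))"
      by (simp add: Q.diff scaleC_diff_left scaleC_diff_right)
    also have "\<dots> = (\<theta> ^ k - \<theta> ^ Suc k) *\<^sub>C Q (v (Suc k))"
      unfolding v by simp
    also have "norm \<dots> = cmod (1 - \<theta>) * norm (Q (v (Suc k)))"
    proof -
      have "\<theta> ^ k - \<theta> ^ Suc k = \<theta> ^ k * (1 - \<theta>)" by (simp add: algebra_simps)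
      then show ?thesis by (simp only: norm_scaleC norm_mult norm_power) simp
    qed
    finally have "c * norm (v k - v (Suc k)) \<le> cmod (1 - \<theta>) * norm (Q (v (Suc k)))"
      using below'[of "\<theta> ^ k" "v k - v (Suc k)"] by (simp add: norm_power)
    then have "c * (c * norm (v k - v (Suc k))) \<le> c * (cmod (1 - \<theta>) * norm (Q (v (Suc k))))"
      using c by simp
    also have "\<dots> \<le> c * (cmod (1 - \<theta>) * (M * norm (v (Suc k))))"
      using M[of 1 "v (Suc k)"] c by (intro mult_left_mono) auto
    also have "\<dots> = cmod (1 - \<theta>) * M * (c * norm (v (Suc k)))"
      by (simp add: mult_ac)
    also have "\<dots> \<le> cmod (1 - \<theta>) * M * ((1 + M) * norm x)"
    \<comment> \<open>For nonzero \<open>x\<close> the exponent 0 in \<open>M\<close> yields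
      \<open>0 \<le> M\<close>; in the zero space \<open>M\<close> could be negative.\<close>
    proof (cases "x = 0")
      case True
      then have "v (Suc k) = 0"
        by (simp add: v_def linear_0[OF bounded_linear.linear[OF bounded_clinear_bounded_linear[OF bounded_clinear_funpow[OF Q]]]])
      then show ?thesis using True by simp
    next
      case False
      then have "0 \<le> M" using M[of 0 x] by (simp add: mult_le_cancel_right2)
      then show ?thesis using v_le by (intro mult_left_mono) auto
    qed
    finally show ?thesis
      using c by (simp add: field_simps power2_eq_square)
  qed
  \<comment> \<open>Summing over \<open>k\<close> first leaves only \<open>j = n\<close>, with
    weight \<open>2 * n\<close>; the factor \<open>1 - \<theta> ^ n = 2\<close> turns this into
    \<open>4 * n\<close>. Passing to neighbouring differences thus keeps \<open>(Q ^^ n) x\<close>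
    while every summand is small.\<close>
  have "(\<Sum>k<2*n. (- 1) ^ k *\<^sub>C (v k - v (Suc k))) =
      (\<Sum>k<2*n. \<Sum>j<2*n. ((- 1) ^ k * (\<theta> ^ k) ^ j * (1 - \<theta> ^ j)) *\<^sub>C (Q ^^ j) x)"
  proof (intro sum.cong refl)
    fix k
    have "v k - v (Suc k) = (\<Sum>j<2*n. ((\<theta> ^ k) ^ j * (1 - \<theta> ^ j)) *\<^sub>C (Q ^^ j) x)"
      by (simp add: v_def flip: sum_subtractf scaleC_diff_left)
         (simp add: algebra_simps power_mult_distrib)
    then show "(- 1) ^ k *\<^sub>C (v k - v (Suc k)) =
        (\<Sum>j<2*n. ((- 1) ^ k * (\<theta> ^ k) ^ j * (1 - \<theta> ^ j)) *\<^sub>C (Q ^^ j) x)"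
      by (simp only: scaleC_sum_right scaleC_scaleC mult.assoc)
  qed
  also have "\<dots> = (\<Sum>j<2*n. ((\<Sum>k<2*n. (- 1) ^ k * (\<theta> ^ k) ^ j) * (1 - \<theta> ^ j)) *\<^sub>C (Q ^^ j) x)"
    by (subst sum.swap) (simp only: scaleC_sum_left[symmetric] sum_distrib_right)
  also have "\<dots> = (\<Sum>j<2*n. if j = n then (2 * of_nat n * (1 - \<theta> ^ n)) *\<^sub>C (Q ^^ n) x else 0)"
    by (intro sum.cong refl) (simp add: \<theta>_def sum_powers_root_of_unity[OF n])
  also have "\<dots> = (4 * of_nat n) *\<^sub>C (Q ^^ n) x"
    using n by (simp add: \<theta>_def cis_pi_div_power)
  finally have "(4 * of_nat n) *\<^sub>C (Q ^^ n) x = (\<Sum>k<2*n. (- 1) ^ k *\<^sub>C (v k - v (Suc k)))"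
    by simp
  then have "4 * real n * norm ((Q ^^ n) x) = norm (\<Sum>k<2*n. (- 1) ^ k *\<^sub>C (v k - v (Suc k)))"
    by (simp add: norm_scaleC norm_mult flip: \<open>(4 * of_nat n) *\<^sub>C (Q ^^ n) x = _\<close>)
  also have "\<dots> \<le> (\<Sum>k<2*n. cmod (1 - \<theta>) * M * (1 + M) / c\<^sup>2 * norm x)"
    by (rule sum_norm_le) (simp only: norm_scaleC norm_power norm_minus_cancel norm_one power_one mult_1_left diff)
  also have "\<dots> = 4 * real n * (cmod (1 - \<theta>) * (M * (1 + M) / (2 * c\<^sup>2)) * norm x)"
    by simp
  finally show ?thesis
    using n unfolding \<theta>_def by (subst (asm) mult_le_cancel_left_pos) auto
qed

text \<open>The mixed terms collapse to \<open>P\<close>. The exponent starts at one, since at zero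
  the left side would be \<open>x\<close> and the right side \<open>x - P x\<close>.\<close>

lemma funpow_diff_projection:
  fixes T P :: "'a::real_vector \<Rightarrow> 'a"
  assumes "linear T" "linear P"
    and TP: "\<And>x. T (P x) = P x" and PT: "\<And>x. P (T x) = P x" and PP: "\<And>x. P (P x) = P x"
  shows "((\<lambda>x. T x - P x) ^^ Suc n) x = (T ^^ Suc n) x - P x"
proof (induction n)
  case (Suc n)
  have "P ((T ^^ n) x) = P x" for n
    by (induction n) (auto simp: PT)
  moreover have "((\<lambda>x. T x - P x) ^^ Suc (Suc n)) x = T ((T ^^ Suc n) x - P x) - P ((T ^^ Suc n) x - P x)"
    unfolding funpow.simps(2)[of "Suc n"] comp_apply Suc ..
  ultimately show ?case
    by (simp add: linear_diff[OF assms(1)] linear_diff[OF assms(2)] TP PT PP)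
qed simp

text \<open>Once the bounds from below are uniform over the circle, \<open>onorm (Q ^^ n)\<close> is
  at most a constant times \<open>cmod (1 - cis (pi / n))\<close>, which tends to 0.\<close>

lemma funpow_tendsto_zero:
  assumes Q: "bounded_clinear Q"
    and below: "\<And>\<mu>. cmod \<mu> = 1 \<Longrightarrow> \<exists>c>0. \<forall>x. c * norm x \<le> norm (\<mu> *\<^sub>C x - Q x)"
    and M: "\<And>n x. norm ((Q ^^ n) x) \<le> M * norm x"
  shows "(\<lambda>n. onorm (Q ^^ n)) \<longlonglongrightarrow> 0"
proof -
  obtain c where c: "c > 0" "\<And>\<mu> x. cmod \<mu> = 1 \<Longrightarrow> c * norm x \<le> norm (\<mu> *\<^sub>C x - Q x)"
    using uniformly_bounded_below_on_circle[OF below] by blast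
  \<comment> \<open>The absolute value gives \<open>0 \<le> L\<close> whatever the sign of
    \<open>M\<close>.\<close>
  define L where "L = \<bar>M * (1 + M) / (2 * c\<^sup>2)\<bar>"
  have bl: "bounded_linear (Q ^^ n)" for n
    by (intro bounded_clinear_bounded_linear bounded_clinear_funpow Q)
  have "onorm (Q ^^ n) \<le> cmod (1 - cis (pi / n)) * L" if "n > 0" for n
  proof (rule onorm_bound)
    show "norm ((Q ^^ n) x) \<le> cmod (1 - cis (pi / n)) * L * norm x" for x
    proof -
      have "norm ((Q ^^ n) x) \<le> cmod (1 - cis (pi / n)) * (M * (1 + M) / (2 * c\<^sup>2)) * norm x"
        using funpow_norm_le[OF Q c(1) _ M that] c(2) by blast
      also have "\<dots> \<le> cmod (1 - cis (pi / n)) * L * norm x"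
        unfolding L_def by (intro mult_right_mono mult_left_mono abs_ge_self norm_ge_zero)
      finally show ?thesis .
    qed
  qed (simp add: L_def)
  then have ev: "eventually (\<lambda>n. norm (onorm (Q ^^ n)) \<le> cmod (1 - cis (pi / n)) * L) sequentially"
    using onorm_pos_le[OF bl] by (intro eventually_sequentiallyI[of 1]) auto
  have "(\<lambda>n. pi / real n) \<longlonglongrightarrow> 0"
    by (rule lim_const_over_n)
  then have "(\<lambda>n. cmod (1 - cis (pi / real n)) * L) \<longlonglongrightarrow> cmod (1 - cis 0) * L"
    unfolding cis_conv_exp by (intro tendsto_intros)
  then show ?thesis
    using Lim_null_comparison[OF ev] by simp
qed

section \<open>Eigenfunctions of weighted composition operators\<close>

lemma holomorphic_on_funpow:
  assumes "\<phi> holomorphic_on S" "\<phi> ` S \<subseteq> S"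
  shows "(\<phi> ^^ n) holomorphic_on S \<and> (\<phi> ^^ n) ` S \<subseteq> S"
proof (induction n)
  case (Suc n)
  then show ?case
    using assms by (auto intro!: holomorphic_on_compose_gen[where t = S and g = \<phi>] simp del: comp_apply)
      (auto simp: image_subset_iff)
qed (auto simp: id_def)

lemma deriv_funpow_fixed_point:
  assumes "\<phi> holomorphic_on S" "open S" "\<alpha> \<in> S" "\<phi> \<alpha> = \<alpha>"
  shows "((\<phi> ^^ n) has_field_derivative deriv \<phi> \<alpha> ^ n) (at \<alpha>)"
proof (induction n)
  case (Suc n)
  have "(\<phi> ^^ n) \<alpha> = \<alpha>" by (induction n) (auto simp: assms)
  moreover have "(\<phi> has_field_derivative deriv \<phi> \<alpha>) (at \<alpha>)"
    using assms by (intro holomorphic_derivI)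
  ultimately show ?case
    using DERIV_chain[OF _ Suc, of \<phi> "deriv \<phi> \<alpha>"] by (simp add: comp_def)
qed (auto simp: id_def)

text \<open>The orbit of \<alpha> converges to \<alpha>, so continuity makes \<alpha> a fixed point.
  Some iterate maps a disc of radius \<open>r\<close> around \<alpha> into the disc of half the
  radius, and Cauchy's estimate bounds its derivative \<open>deriv \<phi> \<alpha> ^ n\<close> by
  1/2.\<close>

lemma denjoy_wolff_fixed_point:
  assumes "\<phi> holomorphic_on unit_disc" "\<phi> ` unit_disc \<subseteq> unit_disc"
    and dw: "denjoy_wolff_point \<phi> \<alpha>" and \<alpha>: "\<alpha> \<in> unit_disc"
  shows "\<phi> \<alpha> = \<alpha>" and "cmod (deriv \<phi> \<alpha>) < 1"
proof -
  have unif: "uniform_limit K (\<lambda>n. \<phi> ^^ n) (\<lambda>_. \<alpha>) sequentially" if "compact K" "K \<subseteq> unit_disc" for K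
    using dw that by (auto simp: denjoy_wolff_point_def)
  have lim: "(\<lambda>n. (\<phi> ^^ n) \<alpha>) \<longlonglongrightarrow> \<alpha>"
    using tendsto_uniform_limitI[OF unif[of "{\<alpha>}"], of \<alpha>] \<alpha> by simp
  have "isCont \<phi> \<alpha>"
    using holomorphic_on_imp_continuous_on[OF assms(1)] \<alpha> by (metis continuous_on_eq_continuous_at open_ball)
  then have "(\<lambda>n. \<phi> ((\<phi> ^^ n) \<alpha>)) \<longlonglongrightarrow> \<phi> \<alpha>"
    using lim by (rule isCont_tendsto_compose)
  moreover have "(\<lambda>n. \<phi> ((\<phi> ^^ n) \<alpha>)) \<longlonglongrightarrow> \<alpha>"
    using LIMSEQ_Suc[OF lim] by simp
  ultimately show fixed: "\<phi> \<alpha> = \<alpha>"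
    using LIMSEQ_unique by blast
  obtain r where r: "r > 0" "cball \<alpha> r \<subseteq> unit_disc"
    using \<alpha> open_contains_cball by blast
  have "\<forall>\<^sub>F n in sequentially. \<forall>z\<in>cball \<alpha> r. dist ((\<phi> ^^ n) z) \<alpha> < r / 2"
    using uniform_limitD[OF unif[OF compact_cball r(2)], of "r / 2"] r(1) by simp
  then obtain n where n: "\<And>z. z \<in> cball \<alpha> r \<Longrightarrow> dist ((\<phi> ^^ n) z) \<alpha> < r / 2"
    unfolding eventually_sequentially by blast
  have hol: "(\<lambda>z. (\<phi> ^^ n) z - \<alpha>) holomorphic_on unit_disc"
    using holomorphic_on_funpow[OF assms(1,2)] by (intro holomorphic_intros) auto
  have "((\<lambda>z. (\<phi> ^^ n) z - \<alpha>) has_field_derivative deriv \<phi> \<alpha> ^ n) (at \<alpha>)"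
    using DERIV_diff[OF deriv_funpow_fixed_point[OF assms(1) open_ball \<alpha> fixed, of n] DERIV_const] by simp
  then have "deriv (\<lambda>z. (\<phi> ^^ n) z - \<alpha>) \<alpha> = deriv \<phi> \<alpha> ^ n"
    by (rule DERIV_imp_deriv)
  moreover have "norm ((deriv ^^ 1) (\<lambda>z. (\<phi> ^^ n) z - \<alpha>) \<alpha>) \<le> fact 1 * (r / 2) / r ^ 1"
  proof (rule Cauchy_inequality)
    show "(\<lambda>z. (\<phi> ^^ n) z - \<alpha>) holomorphic_on ball \<alpha> r"
      using hol r(2) by (meson ball_subset_cball holomorphic_on_subset order_trans)
    show "continuous_on (cball \<alpha> r) (\<lambda>z. (\<phi> ^^ n) z - \<alpha>)"
      using hol r(2) by (meson holomorphic_on_imp_continuous_on continuous_on_subset)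
    show "norm ((\<phi> ^^ n) z - \<alpha>) \<le> r / 2" if "norm (\<alpha> - z) = r" for z
      using n[of z] that by (simp add: dist_norm)
  qed (fact r(1))
  ultimately have "cmod (deriv \<phi> \<alpha>) ^ n \<le> 1 / 2"
    using r(1) by (simp add: norm_power)
  then show "cmod (deriv \<phi> \<alpha>) < 1"
    using one_le_power[of "cmod (deriv \<phi> \<alpha>)" n] by linarith
qed

text \<open>Comparing leading coefficients at the fixed point, a zero of order \<open>n\<close> there forces
  \<open>\<mu> = w \<alpha> * \<phi>'(\<alpha>) ^ n\<close>.\<close>

lemma eigenfunction_eq_zero:
  assumes hol: "f holomorphic_on S" "w holomorphic_on S" "\<phi> holomorphic_on S"
    and S: "open S" "connected S" "\<alpha> \<in> S"
    and \<phi>: "\<phi> \<alpha> = \<alpha>" "cmod (deriv \<phi> \<alpha>) < 1"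
    and eq: "\<And>z. z \<in> S \<Longrightarrow> w z * f (\<phi> z) = \<mu> * f z"
    and "cmod (w \<alpha>) \<le> 1" "cmod \<mu> = 1" "f \<alpha> = 0" "z \<in> S"
  shows "f z = 0"
proof (rule ccontr)
  assume "f z \<noteq> 0"
  then have "\<not> f constant_on S"
    using \<open>\<alpha> \<in> S\<close> \<open>f \<alpha> = 0\<close> \<open>z \<in> S\<close> by (metis constant_on_def)
  then obtain g r n where n: "0 < n" and r: "0 < r" "ball \<alpha> r \<subseteq> S" and g: "g holomorphic_on ball \<alpha> r"
    and fg: "\<And>z. z \<in> ball \<alpha> r \<Longrightarrow> f z = (z - \<alpha>) ^ n * g z" and g0: "\<And>z. z \<in> ball \<alpha> r \<Longrightarrow> g z \<noteq> 0"
    using holomorphic_factor_zero_nonconstant[OF hol(1) S] \<open>f \<alpha> = 0\<close> by metis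
  have cont_g: "isCont g \<alpha>"
    using holomorphic_on_imp_continuous_on[OF g] r
    by (metis centre_in_ball continuous_on_eq_continuous_at open_ball)
  have cont_w: "isCont w \<alpha>" and cont_\<phi>: "isCont \<phi> \<alpha>"
    using holomorphic_on_imp_continuous_on[OF hol(2)] holomorphic_on_imp_continuous_on[OF hol(3)] S
    by (auto simp: continuous_on_eq_continuous_at)
  have "(\<phi> has_field_derivative deriv \<phi> \<alpha>) (at \<alpha>)"
    using hol S by (intro holomorphic_derivI)
  then have quot: "((\<lambda>z. (\<phi> z - \<alpha>) / (z - \<alpha>)) \<longlongrightarrow> deriv \<phi> \<alpha>) (at \<alpha>)"
    by (simp add: has_field_derivative_iff \<phi>)
  have lim_\<phi>: "(\<phi> \<longlongrightarrow> \<alpha>) (at \<alpha>)"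
    using cont_\<phi> \<phi> by (simp add: isCont_def)
  \<comment> \<open>The eigenvalue equation is divided by \<open>(z - \<alpha>) ^ n\<close>, with
    \<open>n\<close> the order of the zero, and both sides are compared in the limit at
    \<alpha>.\<close>
  have "((\<lambda>z. w z * ((\<phi> z - \<alpha>) / (z - \<alpha>)) ^ n * g (\<phi> z)) \<longlongrightarrow> w \<alpha> * deriv \<phi> \<alpha> ^ n * g \<alpha>) (at \<alpha>)"
    using cont_w quot isCont_tendsto_compose[OF cont_g lim_\<phi>]
    by (intro tendsto_intros) (auto simp: isCont_def)
  moreover have "\<forall>\<^sub>F z in at \<alpha>. w z * ((\<phi> z - \<alpha>) / (z - \<alpha>)) ^ n * g (\<phi> z) = \<mu> * g z"
  proof -
    have "\<forall>\<^sub>F z in at \<alpha>. \<phi> z \<in> ball \<alpha> r"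
      using lim_\<phi> r by (intro topological_tendstoD) auto
    moreover have "\<forall>\<^sub>F z in at \<alpha>. z \<in> ball \<alpha> r"
      using r by (intro eventually_at_in_open') auto
    moreover have "\<forall>\<^sub>F z in at \<alpha>. z \<noteq> \<alpha>"
      by (simp add: eventually_at_filter)
    ultimately show ?thesis
    proof eventually_elim
      case (elim z)
      then have "w z * ((\<phi> z - \<alpha>) ^ n * g (\<phi> z)) = \<mu> * ((z - \<alpha>) ^ n * g z)"
        using eq[of z] fg[of z] fg[of "\<phi> z"] r by auto
      then show ?case
        using elim by (simp add: power_divide field_simps)
    qed
  qed
  ultimately have "((\<lambda>z. \<mu> * g z) \<longlongrightarrow> w \<alpha> * deriv \<phi> \<alpha> ^ n * g \<alpha>) (at \<alpha>)"
    by (rule Lim_transform_eventually)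
  moreover have "((\<lambda>z. \<mu> * g z) \<longlongrightarrow> \<mu> * g \<alpha>) (at \<alpha>)"
    using cont_g by (intro tendsto_intros) (simp add: isCont_def)
  ultimately have "w \<alpha> * deriv \<phi> \<alpha> ^ n * g \<alpha> = \<mu> * g \<alpha>"
    using tendsto_unique[OF at_neq_bot] by blast
  then have "w \<alpha> * deriv \<phi> \<alpha> ^ n = \<mu>"
    using g0[of \<alpha>] r by simp
  \<comment> \<open>Impossible: as \<open>n > 0\<close> and the multiplier has modulus below 1, the
    product is less than 1.\<close>
  then have "cmod (w \<alpha>) * cmod (deriv \<phi> \<alpha>) ^ n = 1"
    using \<open>cmod \<mu> = 1\<close> by (metis norm_mult norm_power)
  moreover have "cmod (w \<alpha>) * cmod (deriv \<phi> \<alpha>) ^ n \<le> cmod (deriv \<phi> \<alpha>) ^ n"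
    using \<open>cmod (w \<alpha>) \<le> 1\<close> by (simp add: mult_left_le_one_le)
  moreover have "cmod (deriv \<phi> \<alpha>) ^ n < 1"
    using \<phi>(2) n by (simp add: power_less_one_iff)
  ultimately show False by linarith
qed

section \<open>Norm convergence of the powers and the essential spectral radius\<close>

theorem theorem2p3:
  fixes J :: "'a::complex_banach \<Rightarrow> complex \<Rightarrow> complex"
    and w \<phi> :: "complex \<Rightarrow> complex"
    and T :: "'a \<Rightarrow> 'a"
    and \<alpha> :: complex
  assumes "holomorphic_function_space J"
    and "\<exists>e. \<forall>z\<in>unit_disc. J e z = 1"
    and "w holomorphic_on unit_disc"
    and "\<phi> holomorphic_on unit_disc" and "\<phi> ` unit_disc \<subseteq> unit_disc"
    and "\<not> elliptic_automorphism \<phi>"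
    and "weighted_composition_operator J w \<phi> T"
    and "bounded_clinear T"
    and "bdd_above (range (\<lambda>n. onorm (T ^^ n)))"
    and "denjoy_wolff_point \<phi> \<alpha>" and "\<alpha> \<in> unit_disc"
    and "cmod (w \<alpha>) < 1 \<or> w \<alpha> = 1"
  shows "powers_converge_uniformly T \<longleftrightarrow> ess_spectral_radius T < 1"
proof -
  interpret T: bounded_linear T
    using assms(8) by (rule bounded_clinear_bounded_linear)
  note \<alpha> = \<open>\<alpha> \<in> unit_disc\<close>
  note fixpoint = denjoy_wolff_fixed_point[OF assms(4,5,10,11)]
  have J_hol: "J f holomorphic_on unit_disc" for f
    using assms(1) by (simp add: holomorphic_function_space_def)
  have J_add: "J (f + g) z = J f z + J g z" and J_scale: "J (c *\<^sub>C f) z = c * J f z"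
    if "z \<in> unit_disc" for f g c z
    using assms(1) that by (simp_all add: holomorphic_function_space_def)
  have J_inj: "f = g" if "\<And>z. z \<in> unit_disc \<Longrightarrow> J f z = J g z" for f g
    using assms(1) that by (simp add: holomorphic_function_space_def)
  have J_0: "J 0 z = 0" if "z \<in> unit_disc" for z
    using J_scale[OF that, of 0 0] by simp
  have J_diff: "J (f - g) \<alpha> = J f \<alpha> - J g \<alpha>" for f g
    using J_add[OF \<alpha>, of "f - g" g] by simp
  have J_T: "J (T f) z = w z * J f (\<phi> z)" if "z \<in> unit_disc" for f z
    using assms(7) that by (simp add: weighted_composition_operator_def)
  have J_T\<alpha>: "J (T f) \<alpha> = w \<alpha> * J f \<alpha>" for f
    using J_T[OF \<alpha>] fixpoint(1) by simp

  have eigen_zero: "f = 0" if "T f = \<mu> *\<^sub>C f" "cmod \<mu> = 1" "J f \<alpha> = 0" for f \<mu>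
  proof (rule J_inj)
    fix z :: complex
    assume z: "z \<in> unit_disc"
    have "J f z = 0"
    proof (rule eigenfunction_eq_zero[OF J_hol assms(3,4) _ _ \<alpha> fixpoint _ _ that(2,3) z])
      show "w z * J f (\<phi> z) = \<mu> * J f z" if "z \<in> unit_disc" for z
        using J_T[OF that, of f] J_scale[OF that, of \<mu> f] \<open>T f = _\<close> by simp
      show "cmod (w \<alpha>) \<le> 1" using assms(12) by auto
    qed auto
    then show "J f z = J 0 z" using J_0 z by simp
  qed
  \<comment> \<open>Evaluation at \<alpha> gives \<open>w \<alpha> = \<mu>\<close> unless
    \<open>J f \<alpha> = 0\<close>; the only unimodular value that the hypothesis on
    \<open>w \<alpha>\<close> admits is 1.\<close>
  have eigen_one: "f = 0 \<or> w \<alpha> = 1 \<and> \<mu> = 1" if "T f = \<mu> *\<^sub>C f" "cmod \<mu> = 1" for f \<mu>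
  proof (cases "J f \<alpha> = 0")
    case False
    then have "w \<alpha> = \<mu>"
      using J_T\<alpha>[of f] J_scale[OF \<alpha>, of \<mu> f] that by simp
    then show ?thesis using assms(12) that by auto
  qed (use eigen_zero that in blast)

  \<comment> \<open>\<open>u\<close> is a fixed vector normalised at \<alpha>, or 0 if that is the
    only fixed vector. A fixed \<open>g\<close> and \<open>J g \<alpha> *\<^sub>C u\<close> differ
    by a fixed vector vanishing at \<alpha>, so they agree by \<open>eigen_zero\<close>.\<close>
  obtain u where u: "T u = u" "u = 0 \<or> J u \<alpha> = 1" and fixed: "\<And>f. T f = f \<Longrightarrow> f = J f \<alpha> *\<^sub>C u"
  proof (cases "\<exists>f. T f = f \<and> f \<noteq> 0")
    case True
    then obtain f where f: "T f = f" "f \<noteq> 0" by blast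
    then have Jf: "J f \<alpha> \<noteq> 0" using eigen_zero[of f 1] by (auto simp: scaleC_one)
    define u where "u = (1 / J f \<alpha>) *\<^sub>C f"
    have u: "T u = u" "J u \<alpha> = 1"
      using f Jf by (simp_all add: u_def bounded_clinear_scaleC[OF assms(8)] J_scale[OF \<alpha>])
    have "g = J g \<alpha> *\<^sub>C u" if "T g = g" for g
    proof -
      have "g - J g \<alpha> *\<^sub>C u = 0"
        using that u by (intro eigen_zero[of _ 1])
          (auto simp: scaleC_one T.diff bounded_clinear_scaleC[OF assms(8)] J_diff J_scale[OF \<alpha>])
      then show ?thesis by simp
    qed
    with u that show ?thesis by blast
  next
    case False
    then show ?thesis using that[of 0] by (auto simp: T.zero)
  qed

  show ?thesis
  proof

    \<comment> \<open>From norm convergence to an essential spectral radius below one\<close>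
    assume "powers_converge_uniformly T"
    then obtain P where P: "bounded_clinear P"
      and lim: "(\<lambda>n. onorm (\<lambda>x. (T ^^ n) x - P x)) \<longlonglongrightarrow> 0"
      by (auto simp: powers_converge_uniformly_def)
    interpret P: bounded_linear P
      using P by (rule bounded_clinear_bounded_linear)
    have bl: "bounded_linear (\<lambda>x. (T ^^ n) x - P x)" for n
      by (intro bounded_clinear_bounded_linear bounded_clinear_diff bounded_clinear_funpow assms(8) P)
    have lim_x: "(\<lambda>n. (T ^^ n) x) \<longlonglongrightarrow> P x" for x
    proof -
      have "(\<lambda>n. (T ^^ n) x - P x) \<longlonglongrightarrow> 0"
      proof (rule Lim_null_comparison)
        show "\<forall>\<^sub>F n in sequentially. norm ((T ^^ n) x - P x) \<le> onorm (\<lambda>x. (T ^^ n) x - P x) * norm x"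
          using onorm[OF bl] by simp
        show "(\<lambda>n. onorm (\<lambda>x. (T ^^ n) x - P x) * norm x) \<longlonglongrightarrow> 0"
          using tendsto_mult_left_zero[OF lim] .
      qed
      then show ?thesis by (simp add: LIM_zero_iff)
    qed
    \<comment> \<open>\<open>P\<close> inherits these identities as the pointwise limit of the
      powers of \<open>T\<close>.\<close>
    have TP: "T (P x) = P x" for x
      using LIMSEQ_unique[OF T.tendsto[OF lim_x] LIMSEQ_Suc[OF lim_x, unfolded funpow.simps comp_apply]] .
    have PT: "P (T x) = P x" for x
      using LIMSEQ_unique[OF lim_x[of "T x"]] LIMSEQ_Suc[OF lim_x[of x]] by (simp add: funpow_swap1)
    have PP: "P (P x) = P x" for x
    proof -
      have "(T ^^ n) (P x) = P x" for n by (induction n) (auto simp: TP)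
      then show ?thesis using lim_x[of "P x"] by (simp add: LIMSEQ_const_iff)
    qed
    define Q where "Q x = T x - P x" for x
    have Q: "bounded_clinear Q"
      unfolding Q_def by (intro bounded_clinear_diff assms(8) P)
    have Q_pow: "(Q ^^ Suc n) x = (T ^^ Suc n) x - P x" for n x
      using funpow_diff_projection[OF T.linear_axioms P.linear_axioms TP PT PP]
      unfolding Q_def[abs_def] .
    have "\<forall>\<^sub>F n in sequentially. dist (onorm (\<lambda>x. (T ^^ n) x - P x)) 0 < 1 / 2"
      using lim by (rule tendstoD) simp
    then obtain m where m: "\<And>n. n \<ge> m \<Longrightarrow> onorm (\<lambda>x. (T ^^ n) x - P x) < 1 / 2"
      by (force simp: eventually_sequentially dist_norm)
    \<comment> \<open>A positive exponent, since \<open>Q_pow\<close> covers only those.\<close>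
    define N where "N = Suc m"
    have small: "norm ((Q ^^ N) x) \<le> 1 / 2 * norm x" for x
    proof -
      have "norm ((Q ^^ N) x) \<le> onorm (\<lambda>x. (T ^^ N) x - P x) * norm x"
        unfolding N_def Q_pow by (rule onorm) (rule bl)
      also have "\<dots> \<le> 1 / 2 * norm x"
        using m[of N] by (intro mult_right_mono) (auto simp: N_def)
      finally show ?thesis .
    qed
    \<comment> \<open>Chosen so that Bernoulli's inequality gives \<open>r ^ N \<ge> 3 / 4\<close>,
      above the norm bound 1/2 for \<open>Q ^^ N\<close>. A single power of \<open>Q\<close> thus
      excludes every \<mu> of modulus above \<open>r\<close>.\<close>
    define r where "r = 1 - 1 / (4 * real N)"
    have r: "0 < r" "r < 1" by (auto simp: r_def N_def)
    have "1 + real N * (r - 1) \<le> (1 + (r - 1)) ^ N"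
      using r by (intro Bernoulli_inequality) auto
    moreover have "1 + real N * (r - 1) = 3 / 4" by (simp add: r_def N_def)
    ultimately have rN: "1 / 2 < r ^ N" by simp
    have "cmod \<mu> \<le> r" if "\<mu> \<in> ess_spectrum T" for \<mu>
    proof (rule ccontr)
      assume "\<not> cmod \<mu> \<le> r"
      then have "r ^ N \<le> cmod \<mu> ^ N" "\<mu> \<noteq> 0"
        using r by (auto intro: power_mono)
      \<comment> \<open>Values of \<open>P\<close> are fixed by \<open>T\<close>, hence multiples of
        \<open>u\<close>, so \<open>T - Q = P\<close> has rank at most one.\<close>
      moreover have "\<exists>c. T x - Q x = c *\<^sub>C u" for x
        using fixed[OF TP[of x]] by (auto simp: Q_def)
      ultimately have "\<mu> \<notin> ess_spectrum T"
        using rN small by (intro not_in_ess_spectrum[OF assms(8) Q, of "1 / 2" N]) auto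
      then show False using that by contradiction
    qed
    then have "ess_spectral_radius T \<le> r"
      unfolding ess_spectral_radius_def using r by (intro cSup_least) auto
    then show "ess_spectral_radius T < 1" using r by simp
  next

    \<comment> \<open>From an essential spectral radius below one to norm convergence\<close>
    assume radius: "ess_spectral_radius T < 1"
    \<comment> \<open>\<open>Sup\<close> is an upper bound only for a set known to be bounded.
      Taking \<open>Q = T\<close>, \<open>u = 0\<close> and exponent 1 in
      \<open>not_in_ess_spectrum\<close> excludes every \<mu> of modulus above
      \<open>onorm T\<close>.\<close>
    have bdd: "bdd_above (insert 0 (cmod ` ess_spectrum T))"
    proof (rule bdd_aboveI[where M = "onorm T"])
      have pos: "0 \<le> onorm T" using T.bounded_linear_axioms by (rule onorm_pos_le)
      have "cmod \<mu> \<le> onorm T" if "\<mu> \<in> ess_spectrum T" for \<mu>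
      proof (rule ccontr)
        assume "\<not> cmod \<mu> \<le> onorm T"
        moreover have "\<exists>c. T x - T x = c *\<^sub>C (0::'a)" for x by simp
        ultimately have "\<mu> \<notin> ess_spectrum T"
          using onorm[OF T.bounded_linear_axioms] pos
          by (intro not_in_ess_spectrum[OF assms(8,8), of "onorm T" 1 _ 0]) auto
        then show False using that by contradiction
      qed
      then show "x \<le> onorm T" if "x \<in> insert 0 (cmod ` ess_spectrum T)" for x
        using that pos by auto
    qed
    have fredholm: "\<mu> \<notin> ess_spectrum T" if "cmod \<mu> = 1" for \<mu>
    proof
      assume "\<mu> \<in> ess_spectrum T"
      then have "1 \<in> insert 0 (cmod ` ess_spectrum T)" using that by force
      then have "1 \<le> ess_spectral_radius T"
        unfolding ess_spectral_radius_def by (rule cSup_upper) (rule bdd)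
      then show False using radius by simp
    qed

    have "linear (\<lambda>f. J f \<alpha>)"
      by (intro linearI) (simp_all add: J_add[OF \<alpha>] J_scale[OF \<alpha>] scaleR_scaleC scaleR_conv_of_real)
    \<comment> \<open>Continuity of \<open>J\<close> at 0, tested on the compact set
      \<open>{\<alpha>}\<close>.\<close>
    moreover have "((\<lambda>f. J f \<alpha>) \<longlongrightarrow> 0) (nhds 0)"
    proof -
      have "\<forall>f K. compact K \<and> K \<subseteq> unit_disc \<longrightarrow> uniform_limit K J (J f) (nhds f)"
        using assms(1) unfolding holomorphic_function_space_def by (elim conjE)
      then have "compact {\<alpha>} \<and> {\<alpha>} \<subseteq> unit_disc \<longrightarrow> uniform_limit {\<alpha>} J (J 0) (nhds 0)"
        by (elim allE)
      then have "uniform_limit {\<alpha>} J (J 0) (nhds 0)"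
        using \<alpha> by simp
      then have "((\<lambda>f. J f \<alpha>) \<longlongrightarrow> J 0 \<alpha>) (nhds 0)"
        by (rule tendsto_uniform_limitI) (rule singletonI)
      then show ?thesis using J_0[OF \<alpha>] by simp
    qed
    ultimately have eval: "bounded_linear (\<lambda>f. J f \<alpha>)"
      by (rule bounded_linear_continuous_at_0)
    define P where "P f = J f \<alpha> *\<^sub>C u" for f
    have P: "bounded_clinear P"
      unfolding P_def bounded_clinear_def
      using bounded_linear_compose[OF bounded_linear_scaleC_left eval]
      by (simp add: J_scale[OF \<alpha>] scaleC_scaleC)
    interpret P: bounded_linear P
      using P by (rule bounded_clinear_bounded_linear)
    \<comment> \<open>A nonzero \<open>u\<close> is an eigenvector for 1, so
      \<open>eigen_one\<close> applies; the value \<open>w \<alpha> = 1\<close> is what gives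
      \<open>P T = P\<close>.\<close>
    have w1: "w \<alpha> = 1" if "u \<noteq> 0"
      using eigen_one[of u 1] u that by (simp add: scaleC_one)
    have TP: "T (P x) = P x" and PP: "P (P x) = P x" and PT: "P (T x) = P x" for x
      using u w1
      by (cases "u = 0"; simp add: P_def bounded_clinear_scaleC[OF assms(8)] J_scale[OF \<alpha>] J_T\<alpha> T.zero)+
    define Q where "Q x = T x - P x" for x
    have Q: "bounded_clinear Q"
      unfolding Q_def by (intro bounded_clinear_diff assms(8) P)
    have Q_pow: "(Q ^^ Suc n) x = (T ^^ Suc n) x - P x" for n x
      using funpow_diff_projection[OF T.linear_axioms P.linear_axioms TP PT PP]
      unfolding Q_def[abs_def] .
    obtain C where C: "\<And>n. onorm (T ^^ n) \<le> C"
      using assms(9) by (auto simp: bdd_above_def)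
    have bl: "bounded_linear (T ^^ n)" for n
      by (intro bounded_clinear_bounded_linear bounded_clinear_funpow assms(8))
    have T_bound: "norm ((T ^^ n) x) \<le> C * norm x" for n x
      using onorm[OF bl, of n x] C[of n] by (meson mult_right_mono norm_ge_zero order_trans)
    \<comment> \<open>The summand 1 accounts for \<open>n = 0\<close>, where \<open>Q_pow\<close>
      does not apply.\<close>
    have "norm ((Q ^^ n) x) \<le> (1 + C + onorm P) * norm x" for n x
    proof (cases n)
      case 0
      have "0 \<le> C" using C[of 0] onorm_pos_le[OF bl[of 0]] by linarith
      moreover have "0 \<le> onorm P" by (rule onorm_pos_le) (rule P.bounded_linear_axioms)
      ultimately show ?thesis using 0 by (simp add: algebra_simps)
    next
      case (Suc k)
      have "norm ((Q ^^ n) x) \<le> norm ((T ^^ Suc k) x) + norm (P x)"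
        unfolding Suc Q_pow by (rule norm_triangle_ineq4)
      also have "\<dots> \<le> C * norm x + onorm P * norm x"
        by (intro add_mono T_bound onorm P.bounded_linear_axioms)
      finally show ?thesis by (simp add: algebra_simps add_increasing)
    qed
    moreover have "\<exists>c>0. \<forall>x. c * norm x \<le> norm (\<mu> *\<^sub>C x - Q x)" if \<mu>: "cmod \<mu> = 1" for \<mu>
    proof -
      \<comment> \<open>\<open>S\<close> is a left inverse of \<open>\<mu> - T\<close> modulo
        compact operators, and also of \<open>\<mu> - Q = (\<mu> - T) + P\<close>, because
        \<open>S P\<close> has rank at most one.\<close>
      obtain S where S: "bounded_clinear S" and K: "compact_operator (\<lambda>x. S (\<mu> *\<^sub>C x - T x) - x)"
        using fredholm[OF \<mu>] by (auto simp: ess_spectrum_def)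
      interpret S: bounded_linear S
        using S by (rule bounded_clinear_bounded_linear)
      have "\<exists>c. S (P x) = c *\<^sub>C S u" for x
        by (auto simp: P_def bounded_clinear_scaleC[OF S])
      then have "compact_operator (\<lambda>x. S (P x))"
        by (intro compact_operator_rank_one[of _ "S u"] bounded_clinear_compose[OF S P])
      then have "compact_operator (\<lambda>x. (S (\<mu> *\<^sub>C x - T x) - x) + S (P x))"
        by (rule compact_operator_add[OF K])
      then have "compact_operator (\<lambda>x. S (\<mu> *\<^sub>C x - Q x) - x)"
        by (simp add: Q_def S.add S.diff algebra_simps)
      moreover have "bounded_clinear (\<lambda>x. \<mu> *\<^sub>C x - Q x)"
        by (intro bounded_clinear_diff bounded_clinear_scaleC_const Q)
      \<comment> \<open>Applying \<open>P\<close> to \<open>T x = \<mu> x + P x\<close> gives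
        \<open>P x = \<mu> P x + P x\<close>, so \<open>P x = 0\<close> and
        \<open>T x = \<mu> x\<close>. A nonzero \<open>x\<close> would force \<mu> to be 1, and then
        \<open>x = P x = 0\<close>.\<close>
      moreover have "x = 0" if "\<mu> *\<^sub>C x - Q x = 0" for x
      proof -
        have Tx: "T x = \<mu> *\<^sub>C x + P x"
          using that by (simp add: Q_def algebra_simps)
        have "\<mu> *\<^sub>C P x = 0"
          using arg_cong[OF Tx, of P] by (simp add: PT PP P.add bounded_clinear_scaleC[OF P])
        then have "P x = 0"
          using \<mu> by (metis norm_scaleC mult_1 norm_eq_zero)
        then have T: "T x = \<mu> *\<^sub>C x" using Tx by simp
        show "x = 0"
        proof (rule ccontr)
          assume "x \<noteq> 0"
          then have "\<mu> = 1" using eigen_one[OF T \<mu>] by simp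
          then have "x = P x" using T fixed[of x] by (simp add: P_def scaleC_one)
          then show False using \<open>P x = 0\<close> \<open>x \<noteq> 0\<close> by simp
        qed
      qed
      ultimately show ?thesis
        by (intro bounded_below_if_left_inverse_mod_compact[OF _ S])
    qed
    ultimately have "(\<lambda>n. onorm (Q ^^ n)) \<longlonglongrightarrow> 0"
      by (intro funpow_tendsto_zero[OF Q])
    \<comment> \<open>\<open>Q ^^ n\<close> equals \<open>T ^^ n - P\<close> for positive
      \<open>n\<close>, so the limit is carried over along the shifted sequences.\<close>
    then have "(\<lambda>n. onorm (Q ^^ Suc n)) \<longlonglongrightarrow> 0"
      by (rule LIMSEQ_Suc)
    then have "(\<lambda>n. onorm (\<lambda>x. (T ^^ Suc n) x - P x)) \<longlonglongrightarrow> 0"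
      unfolding Q_pow[abs_def, symmetric] .
    then have "(\<lambda>n. onorm (\<lambda>x. (T ^^ n) x - P x)) \<longlonglongrightarrow> 0"
      by (rule LIMSEQ_imp_Suc)
    then show "powers_converge_uniformly T"
      using P by (auto simp: powers_converge_uniformly_def)
  qed
qed

end
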